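(* Let $\mathcal{X}$ be a homogeneous coherent configuration on $n$ points with indistinguishing number $c$ and maximum valency $k$. Suppose that $2c(k-1)<n$. Then every one point extension of $\mathcal{X}$ is $1$-regular. In particular, $b(\mathcal{X})\le 2$.
   Context: Let $\Omega$ be a finite set. For $r\subseteq\Omega\times\Omega$ and $\alpha\in\Omega$ put $r^*=\{(\beta,\alpha):(\alpha,\beta)\in r\}$ and $\alpha r=\{\beta:(\alpha,\beta)\in r\}$; $1_\Omega$ is the diagonal of $\Omega\times\Omega$. A coherent configuration on $\Omega$ is a pair $\mathcal{X}=(\Omega,S)$, where $S$ is a partition of $\Omega\times\Omega$ such that $1_\Omega$ is a union of elements of $S$, $s^*\in S$ for all $s\in S$, and for all $r,s,t\in S$ the intersection number $c_{rs}^t=|\alpha r\cap\beta s^*|$ does not depend on $(\alpha,\beta)\in t$. The elements of $S$ are the basis relations, unions of them are the relations. $\mathcal{X}$ is homogeneous if $1_\Omega\in S$; then the valency $n_s=|\alpha s|$ of $s\in S$ does not depend on $\alpha\in\Omega$, and the maximum valency is $k=\max_{s\in S}n_s$. The indistinguishing number of $r\in S$ is $c(r)=\sum_{s\in S}c_{ss^*}^r$, and the indistinguishing number of $\mathcal{X}$ is $c=\max\{c(r): r\in S,\ r\neq 1_\Omega\}$. A point $\alpha$ of a coherent configuration is regular if $|\alpha r|\le 1$ for all its basis relations $r$; a coherent configuration is $1$-regular if it has a regular point. It is complete if all its basis relations are singletons. For coherent configurations on the same set, $\mathcal{X}\le\mathcal{X}'$ means that every relation of $\mathcal{X}$ is a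 relation of $\mathcal{X}'$. For points $\alpha,\beta,\ldots\in\Omega$ the point extension $\mathcal{X}_{\alpha,\beta,\ldots}$ is the smallest coherent configuration on $\Omega$ that is $\ge\mathcal{X}$ and has $\{(\alpha,\alpha)\},\{(\beta,\beta)\},\ldots$ as relations; a one point extension is $\mathcal{X}_\alpha$ with $\alpha\in\Omega$. A set $\{\alpha,\beta,\ldots\}$ is a base of $\mathcal{X}$ if $\mathcal{X}_{\alpha,\beta,\ldots}$ is complete; $b(\mathcal{X})$ is the smallest cardinality of a base. *)

theory Defs
  imports Main "HOL-Library.Disjoint_Sets"
begin

locale coherent_configuration =
  fixes \<Omega> :: "'a set" and S :: "('a \<times> 'a) set set"
  assumes finite_points: "finite \<Omega>"
    and partition: "partition_on (\<Omega> \<times> \<Omega>) S"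
    and diagonal: "\<exists>U\<subseteq>S. Id_on \<Omega> = \<Union>U"
    and converse_closed: "s \<in> S \<Longrightarrow> s\<inverse> \<in> S"
    and coherent: "\<lbrakk>r \<in> S; s \<in> S; t \<in> S; (\<alpha>, \<beta>) \<in> t; (\<alpha>', \<beta>') \<in> t\<rbrakk> \<Longrightarrow>
      card (r `` {\<alpha>} \<inter> s\<inverse> `` {\<beta>}) = card (r `` {\<alpha>'} \<inter> s\<inverse> `` {\<beta>'})"

locale homogeneous_configuration = coherent_configuration +
  assumes homogeneous: "Id_on \<Omega> \<in> S"

definition relations :: "('a \<times> 'a) set set \<Rightarrow> ('a \<times> 'a) set set" where
  "relations S = {\<Union>U | U. U \<subseteq> S}"

definition intersection_number ::
  "('a \<times> 'a) set \<Rightarrow> ('a \<times> 'a) set \<Rightarrow> ('a \<times> 'a) set \<Rightarrow> nat" where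
  "intersection_number r s t =
    (THE m. \<forall>(\<alpha>, \<beta>)\<in>t. card (r `` {\<alpha>} \<inter> s\<inverse> `` {\<beta>}) = m)"

definition valency :: "'a set \<Rightarrow> ('a \<times> 'a) set \<Rightarrow> nat" where
  "valency \<Omega> s = (THE m. \<forall>\<alpha>\<in>\<Omega>. card (s `` {\<alpha>}) = m)"

definition max_valency :: "'a set \<Rightarrow> ('a \<times> 'a) set set \<Rightarrow> nat" where
  "max_valency \<Omega> S = Max (valency \<Omega> ` S)"

definition rel_indistinguishing_number ::
  "('a \<times> 'a) set set \<Rightarrow> ('a \<times> 'a) set \<Rightarrow> nat" where
  "rel_indistinguishing_number S r = (\<Sum>s\<in>S. intersection_number s (s\<inverse>) r)"

(* Inserting 0 only matters when there is a single point: then the diagonal is the only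
   basis relation, and the maximum over the empty set is read as 0. *)
definition indistinguishing_number :: "'a set \<Rightarrow> ('a \<times> 'a) set set \<Rightarrow> nat" where
  "indistinguishing_number \<Omega> S =
    Max (insert 0 (rel_indistinguishing_number S ` (S - {Id_on \<Omega>})))"

definition regular_point :: "'a set \<Rightarrow> ('a \<times> 'a) set set \<Rightarrow> 'a \<Rightarrow> bool" where
  "regular_point \<Omega> S \<alpha> \<longleftrightarrow> \<alpha> \<in> \<Omega> \<and> (\<forall>r\<in>S. card (r `` {\<alpha>}) \<le> 1)"

definition one_regular :: "'a set \<Rightarrow> ('a \<times> 'a) set set \<Rightarrow> bool" where
  "one_regular \<Omega> S \<longleftrightarrow> (\<exists>\<alpha>. regular_point \<Omega> S \<alpha>)"

definition complete_configuration :: "('a \<times> 'a) set set \<Rightarrow> bool" where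
  "complete_configuration S \<longleftrightarrow> (\<forall>s\<in>S. is_singleton s)"

definition config_le :: "('a \<times> 'a) set set \<Rightarrow> ('a \<times> 'a) set set \<Rightarrow> bool" where
  "config_le S S' \<longleftrightarrow> relations S \<subseteq> relations S'"

definition extends_at_points ::
  "'a set \<Rightarrow> ('a \<times> 'a) set set \<Rightarrow> 'a set \<Rightarrow> ('a \<times> 'a) set set \<Rightarrow> bool" where
  "extends_at_points \<Omega> S A T \<longleftrightarrow>
    coherent_configuration \<Omega> T \<and> config_le S T \<and> (\<forall>\<alpha>\<in>A. {(\<alpha>, \<alpha>)} \<in> relations T)"

(* The least element exists for every A \<subseteq> \<Omega>: the sets that are relations of all
   configurations extending S at A are again the relations of a coherent configuration.
   It is unique because the basis relations are the minimal nonempty relations. *)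
definition point_extension ::
  "'a set \<Rightarrow> ('a \<times> 'a) set set \<Rightarrow> 'a set \<Rightarrow> ('a \<times> 'a) set set" where
  "point_extension \<Omega> S A =
    (THE T. extends_at_points \<Omega> S A T \<and> (\<forall>T'. extends_at_points \<Omega> S A T' \<longrightarrow> config_le T T'))"

definition is_base :: "'a set \<Rightarrow> ('a \<times> 'a) set set \<Rightarrow> 'a set \<Rightarrow> bool" where
  "is_base \<Omega> S A \<longleftrightarrow> A \<subseteq> \<Omega> \<and> complete_configuration (point_extension \<Omega> S A)"

definition base_number :: "'a set \<Rightarrow> ('a \<times> 'a) set set \<Rightarrow> nat" where
  "base_number \<Omega> S = Min (card ` {A. is_base \<Omega> S A})"

end

(* Fix a point a. For a point y with (a, y) in s, a point b fails to separate y from the other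
   points of a s (in the sense that y is the only point of a s in its relation to b) only if b is
   indistinguishing for y and one of the at most k - 1 other points of a s. So at most c (k - 1) < n / 2
   points b fail, and by double counting some b separates more than half of the points y from the
   rest of a s. This b is regular in every coherent configuration above the given one in which {(a, a)}
   is a relation: any point e is separated by more than half of the points, hence by some d that is itself
   separated by b; thus b determines d, and d determines e. *)
theory Submission
  imports Defs
begin

section \<open>Partitions, their blocks and the unions of blocks\<close>

definition same_block :: "'b set set \<Rightarrow> 'b \<Rightarrow> 'b \<Rightarrow> bool" where
  "same_block P x y \<longleftrightarrow> (\<exists>p\<in>P. x \<in> p \<and> y \<in> p)"

lemma same_block_sym: "same_block P x y \<Longrightarrow> same_block P y x"
  by (auto simp: same_block_def)

lemma same_block_iff_mem:
  assumes "partition_on A P" "p \<in> P" "x \<in> p"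
  shows "same_block P x y \<longleftrightarrow> y \<in> p"
  using assms unfolding same_block_def partition_on_def disjoint_def by blast

text \<open>Unions of blocks are the saturated sets, since a saturated set is the union of the
  blocks inside it. This turns membership in \<open>relations\<close> into a closure
  condition.\<close>

lemma relations_iff:
  assumes "partition_on A P"
  shows "X \<in> relations P \<longleftrightarrow> X \<subseteq> A \<and> (\<forall>x y. same_block P x y \<longrightarrow> x \<in> X \<longrightarrow> y \<in> X)"
proof
  assume "X \<in> relations P"
  then obtain U where U: "U \<subseteq> P" "X = \<Union>U" by (auto simp: relations_def)
  then show "X \<subseteq> A \<and> (\<forall>x y. same_block P x y \<longrightarrow> x \<in> X \<longrightarrow> y \<in> X)"
    using assms same_block_iff_mem[OF assms]
    by (auto simp: partition_on_def) blast
next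
  assume X: "X \<subseteq> A \<and> (\<forall>x y. same_block P x y \<longrightarrow> x \<in> X \<longrightarrow> y \<in> X)"
  have "X = \<Union>{p\<in>P. p \<subseteq> X}"
  proof
    show "X \<subseteq> \<Union>{p\<in>P. p \<subseteq> X}"
    proof
      fix x assume "x \<in> X"
      with X assms obtain p where p: "p \<in> P" "x \<in> p" by (auto simp: partition_on_def)
      with X \<open>x \<in> X\<close> have "p \<subseteq> X" unfolding same_block_def by blast
      with p show "x \<in> \<Union>{p\<in>P. p \<subseteq> X}" by blast
    qed
  qed blast
  then show "X \<in> relations P" unfolding relations_def by blast
qed

lemma block_in_relations: "p \<in> P \<Longrightarrow> p \<in> relations P"
  unfolding relations_def by (rule CollectI, rule exI[of _ "{p}"]) auto

text \<open>More relations mean finer blocks: a block of \<open>P\<close> is a relation of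
  \<open>Q\<close>, so it contains every block of \<open>Q\<close> that it meets.\<close>

lemma same_block_mono:
  assumes "partition_on A P" "partition_on A Q" "config_le P Q" "same_block Q x y"
  shows "same_block P x y"
proof -
  have "x \<in> A" using assms(2,4) by (auto simp: same_block_def partition_on_def)
  with assms(1) obtain p where p: "p \<in> P" "x \<in> p" by (auto simp: partition_on_def)
  then have "p \<in> relations Q" using assms(3) block_in_relations by (auto simp: config_le_def)
  then have "y \<in> p" using relations_iff[OF assms(2)] assms(4) p by blast
  with p show ?thesis by (auto simp: same_block_def)
qed

text \<open>The blocks can be recovered from their unions. This makes \<open>config_le\<close>
  antisymmetric on partitions, hence the least extension unique.\<close>

lemma partition_subset_if_relations_eq:
  assumes "partition_on A P" "partition_on A Q" "relations P = relations Q"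
  shows "P \<subseteq> Q"
proof
  fix p assume p: "p \<in> P"
  with assms(1) have "p \<noteq> {}" "p \<subseteq> A" by (auto simp: partition_on_def)
  then obtain x where x: "x \<in> p" "x \<in> A" by blast
  with assms(2) obtain q where q: "q \<in> Q" "x \<in> q" by (auto simp: partition_on_def)
  have "same_block P x y \<longleftrightarrow> same_block Q x y" for y
    using same_block_mono[OF assms(1,2)] same_block_mono[OF assms(2,1)] assms(3)
    unfolding config_le_def by blast
  then have "p = q"
    using same_block_iff_mem[OF assms(1) p x(1)] same_block_iff_mem[OF assms(2) q] by blast
  with q show "p \<in> Q" by simp
qed

section \<open>Paths and fixed points in a coherent configuration\<close>

context coherent_configuration
begin

lemma same_block_points:
  "same_block S (x, y) (x', y') \<Longrightarrow> x \<in> \<Omega> \<and> y \<in> \<Omega> \<and> x' \<in> \<Omega> \<and> y' \<in> \<Omega>"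
  using partition by (auto simp: same_block_def partition_on_def)

lemma basis_relation_subset: "s \<in> S \<Longrightarrow> s \<subseteq> \<Omega> \<times> \<Omega>"
  using partition by (auto simp: partition_on_def)

lemma finite_neighbours: "s \<in> S \<Longrightarrow> finite (s `` {x})"
  by (rule finite_subset[OF _ finite_points]) (use basis_relation_subset in auto)

lemma finite_basis_relations: "finite S"
  using finite_elements[OF _ partition] finite_points by simp

lemma obtain_basis_relation:
  assumes "x \<in> \<Omega>" "y \<in> \<Omega>" obtains s where "s \<in> S" "(x, y) \<in> s"
  using assms partition by (auto simp: partition_on_def)

lemma same_block_converse: "same_block S (x, y) (x', y') \<Longrightarrow> same_block S (y, x) (y', x')"
  unfolding same_block_def using converse_closed by blast

text \<open>The qualitative form of coherence: an intersection number that is positive at one pair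
  of a basis relation is positive at all of them, so the path x, z, y has a copy from x' to
  y'.\<close>

lemma same_block_transport:
  assumes "same_block S (x, y) (x', y')" "z \<in> \<Omega>"
  obtains z' where "same_block S (x, z) (x', z')" "same_block S (z, y) (z', y')"
proof -
  obtain t where t: "t \<in> S" "(x, y) \<in> t" "(x', y') \<in> t"
    using assms(1) by (auto simp: same_block_def)
  have "x \<in> \<Omega>" "y \<in> \<Omega>" using same_block_points[OF assms(1)] by auto
  then obtain r s where r: "r \<in> S" "(x, z) \<in> r" and s: "s \<in> S" "(z, y) \<in> s"
    using obtain_basis_relation assms(2) by metis
  have "card (r `` {x} \<inter> s\<inverse> `` {y}) \<noteq> 0"
    using r s finite_neighbours[OF r(1), of x] by auto
  then have "card (r `` {x'} \<inter> s\<inverse> `` {y'}) \<noteq> 0"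
    using coherent[OF r(1) s(1) t] by simp
  then obtain z' where "z' \<in> r `` {x'} \<inter> s\<inverse> `` {y'}"
    by (metis card.empty ex_in_conv)
  then show ?thesis using that[of z'] r s by (auto simp: same_block_def)
qed

text \<open>Transporting \<open>a\<close> as the intermediate point sends (a, a) to (a', z), which
  has to stay in the relation {(a, a)}.\<close>

lemma same_block_fixed_point:
  assumes "{(a, a)} \<in> relations S" "same_block S (a, y) (a', y')"
  shows "a' = a"
proof -
  have "a \<in> \<Omega>" using same_block_points[OF assms(2)] by simp
  with assms(2) obtain z where "same_block S (a, a) (a', z)" by (rule same_block_transport)
  then show ?thesis using assms(1) relations_iff[OF partition] by blast
qed

lemma relations_converse:
  assumes "X \<in> relations S" shows "X\<inverse> \<in> relations S"
proof -
  have *: "X \<subseteq> \<Omega> \<times> \<Omega>" "\<And>x y. same_block S x y \<Longrightarrow> x \<in> X \<Longrightarrow> y \<in> X"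
    using assms relations_iff[OF partition] by auto
  show ?thesis unfolding relations_iff[OF partition]
    using *(1) *(2)[OF same_block_converse] by auto
qed

lemma Id_on_in_relations: "Id_on \<Omega> \<in> relations S"
  using diagonal by (auto simp: relations_def)

text \<open>Path counts are additive, so coherence passes to unions of basis relations. A relation
  shared by several configurations need not be a basis relation of any of them, so the least
  extension calls for this generality.\<close>

lemma card_relations_path:
  assumes "r \<in> relations S" "s \<in> relations S" "same_block S (x, y) (x', y')"
  shows "card (r `` {x} \<inter> s\<inverse> `` {y}) = card (r `` {x'} \<inter> s\<inverse> `` {y'})"
proof -
  obtain R Q where R: "R \<subseteq> S" "r = \<Union>R" and Q: "Q \<subseteq> S" "s = \<Union>Q"
    using assms(1,2) by (auto simp: relations_def)
  obtain t where t: "t \<in> S" "(x, y) \<in> t" "(x', y') \<in> t"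
    using assms(3) by (auto simp: same_block_def)
  have disj: "p \<inter> q = {}" if "p \<in> S" "q \<in> S" "p \<noteq> q" for p q
    using that partition by (auto simp: partition_on_def disjoint_def)
  have *: "card (r `` {u} \<inter> s\<inverse> `` {v}) =
      (\<Sum>(p, q)\<in>R \<times> Q. card (p `` {u} \<inter> q\<inverse> `` {v}))" for u v
  proof -
    have "r `` {u} \<inter> s\<inverse> `` {v} = (\<Union>i\<in>R \<times> Q. fst i `` {u} \<inter> (snd i)\<inverse> `` {v})"
      using R Q by auto
    also have "card \<dots> = (\<Sum>i\<in>R \<times> Q. card (fst i `` {u} \<inter> (snd i)\<inverse> `` {v}))"
    proof (rule card_UN_disjoint)
      show "finite (R \<times> Q)" using R Q finite_basis_relations finite_subset by blast
      show "\<forall>i\<in>R \<times> Q. finite (fst i `` {u} \<inter> (snd i)\<inverse> `` {v})"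
        using R finite_neighbours by auto
      show "\<forall>i\<in>R \<times> Q. \<forall>j\<in>R \<times> Q. i \<noteq> j \<longrightarrow>
          (fst i `` {u} \<inter> (snd i)\<inverse> `` {v}) \<inter> (fst j `` {u} \<inter> (snd j)\<inverse> `` {v}) = {}"
      proof (intro ballI impI)
        fix i j assume ij: "i \<in> R \<times> Q" "j \<in> R \<times> Q" "i \<noteq> j"
        \<comment> \<open>Distinct index pairs differ in a component, and distinct basis relations
          are disjoint.\<close>
        then have "fst i \<inter> fst j = {} \<or> snd i \<inter> snd j = {}"
          using disj R(1) Q(1) by (metis SigmaE fst_conv snd_conv subsetD)
        then show "(fst i `` {u} \<inter> (snd i)\<inverse> `` {v}) \<inter> (fst j `` {u} \<inter> (snd j)\<inverse> `` {v}) = {}"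
          by blast
      qed
    qed
    finally show ?thesis by (simp add: case_prod_unfold)
  qed
  have "(\<Sum>(p, q)\<in>R \<times> Q. card (p `` {x} \<inter> q\<inverse> `` {y})) =
      (\<Sum>(p, q)\<in>R \<times> Q. card (p `` {x'} \<inter> q\<inverse> `` {y'}))"
    by (rule sum.cong[OF refl])
      (use R(1) Q(1) in \<open>auto intro: coherent[OF _ _ t]\<close>)
  then show ?thesis by (simp add: *)
qed

end

subsection \<open>Existence of point extensions\<close>

lemma coherent_configuration_discrete:
  assumes "finite \<Omega>"
  shows "coherent_configuration \<Omega> ((\<lambda>p. {p}) ` (\<Omega> \<times> \<Omega>))"
proof
  show "partition_on (\<Omega> \<times> \<Omega>) ((\<lambda>p. {p}) ` (\<Omega> \<times> \<Omega>))"
    by (auto simp: partition_on_def disjoint_def)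
  show "\<exists>U\<subseteq>(\<lambda>p. {p}) ` (\<Omega> \<times> \<Omega>). Id_on \<Omega> = \<Union>U"
    by (rule exI[of _ "(\<lambda>p. {p}) ` Id_on \<Omega>"]) auto
qed (use assms in auto)

text \<open>Ensures that the family of extensions, whose common relations are taken next, is
  nonempty.\<close>

lemma extends_at_points_discrete:
  assumes "coherent_configuration \<Omega> S" "A \<subseteq> \<Omega>"
  shows "extends_at_points \<Omega> S A ((\<lambda>p. {p}) ` (\<Omega> \<times> \<Omega>))"
proof -
  interpret coherent_configuration \<Omega> S by fact
  interpret D: coherent_configuration \<Omega> "(\<lambda>p. {p}) ` (\<Omega> \<times> \<Omega>)"
    using coherent_configuration_discrete finite_points .
  have "X \<in> relations ((\<lambda>p. {p}) ` (\<Omega> \<times> \<Omega>)) \<longleftrightarrow> X \<subseteq> \<Omega> \<times> \<Omega>" for X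
    unfolding relations_iff[OF D.partition] by (auto simp: same_block_def)
  then show ?thesis
    using D.coherent_configuration_axioms assms(2) relations_iff[OF partition]
    by (auto simp: extends_at_points_def config_le_def)
qed

text \<open>The atoms of the family of relations common to all extensions serve as basis relations.
  They are coherent because the pairs with a given path count again form a common relation.\<close>

lemma least_extension_exists:
  assumes "coherent_configuration \<Omega> S" "A \<subseteq> \<Omega>"
  shows "\<exists>T. extends_at_points \<Omega> S A T \<and> (\<forall>T'. extends_at_points \<Omega> S A T' \<longrightarrow> config_le T T')"
proof -
  define F where "F = {T. extends_at_points \<Omega> S A T}"
  define R where "R = {X. \<forall>T\<in>F. X \<in> relations T}"
  \<comment> \<open>\<open>C p\<close> is the atom around \<open>p\<close>: the pairs that no common
    relation tells apart from \<open>p\<close>.\<close>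
  define C where "C p = {q \<in> \<Omega> \<times> \<Omega>. \<forall>X\<in>R. p \<in> X \<longleftrightarrow> q \<in> X}" for p
  define T where "T = C ` (\<Omega> \<times> \<Omega>)"
  have coh: "coherent_configuration \<Omega> U" if "U \<in> F" for U
    using that by (simp add: F_def extends_at_points_def)
  note part = coherent_configuration.partition[OF coh]
  \<comment> \<open>Common relations are the sets saturated for all extensions at once;
    \<open>RI\<close> and \<open>RD\<close> are the two directions.\<close>
  have RI: "X \<in> R"
    if "X \<subseteq> \<Omega> \<times> \<Omega>" "\<And>U p q. U \<in> F \<Longrightarrow> same_block U p q \<Longrightarrow> p \<in> X \<Longrightarrow> q \<in> X" for X
    unfolding R_def using relations_iff[OF part] that by blast
  have RD: "q \<in> X" if "X \<in> R" "U \<in> F" "same_block U p q" "p \<in> X" for X U p q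
    using relations_iff[OF part] that unfolding R_def by blast
  have F_ne: "(\<lambda>p. {p}) ` (\<Omega> \<times> \<Omega>) \<in> F"
    unfolding F_def using extends_at_points_discrete[OF assms] by simp
  \<comment> \<open>With \<open>F\<close> empty, every set would lie in \<open>R\<close>; the
    discrete configuration excludes this.\<close>
  have R_sub: "X \<subseteq> \<Omega> \<times> \<Omega>" if "X \<in> R" for X
    using F_ne that relations_iff[OF part[OF F_ne]] unfolding R_def by blast
  have partT: "partition_on (\<Omega> \<times> \<Omega>) T"
  proof (rule partition_onI)
    show "\<Union>T = \<Omega> \<times> \<Omega>" by (auto simp: T_def C_def)
    show "disjnt p q" if "p \<in> T" "q \<in> T" "p \<noteq> q" for p q
      using that unfolding T_def C_def disjnt_def by blast
    show "{} \<notin> T" by (auto simp: T_def C_def)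
  qed
  \<comment> \<open>Atoms are common relations themselves, as two pairs in one block of an extension
    lie in the same members of \<open>R\<close>.\<close>
  have C_R: "C p \<in> R" for p
  proof (rule RI)
    show "C p \<subseteq> \<Omega> \<times> \<Omega>" by (auto simp: C_def)
    fix U u v assume U: "U \<in> F" and uv: "same_block U u v" and u: "u \<in> C p"
    have "v \<in> \<Omega> \<times> \<Omega>" using coherent_configuration.same_block_points[OF coh[OF U]] uv
      by (metis SigmaI surj_pair)
    moreover have "u \<in> X \<longleftrightarrow> v \<in> X" if "X \<in> R" for X
      using RD[OF that U uv] RD[OF that U same_block_sym[OF uv]] by blast
    ultimately show "v \<in> C p" using u by (auto simp: C_def)
  qed
  have sbT: "same_block T p q \<longleftrightarrow> p \<in> \<Omega> \<times> \<Omega> \<and> q \<in> C p" for p q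
  proof (cases "p \<in> \<Omega> \<times> \<Omega>")
    case True
    then have "C p \<in> T" "p \<in> C p" unfolding T_def by (blast, simp add: C_def)
    then show ?thesis using same_block_iff_mem[OF partT] True by simp
  next
    case False
    then show ?thesis using partT unfolding same_block_def partition_on_def by blast
  qed
  have relT: "relations T = R"
  proof (intro equalityI subsetI)
    fix X assume "X \<in> relations T"
    then have X: "X \<subseteq> \<Omega> \<times> \<Omega>" "\<And>p q. same_block T p q \<Longrightarrow> p \<in> X \<Longrightarrow> q \<in> X"
      using relations_iff[OF partT] by auto
    show "X \<in> R"
    proof (rule RI[OF X(1)])
      fix U p q assume *: "U \<in> F" "same_block U p q" "p \<in> X"
      have "p \<in> C p" using X(1) * by (auto simp: C_def)
      then have "q \<in> C p" using RD[OF C_R] * by blast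
      then show "q \<in> X" using X * sbT by blast
    qed
  next
    fix X assume "X \<in> R"
    then show "X \<in> relations T"
      using R_sub relations_iff[OF partT] unfolding sbT by (auto simp: C_def)
  qed
  have R_conv: "X\<inverse> \<in> R" if "X \<in> R" for X
    using that coherent_configuration.relations_converse[OF coh] by (auto simp: R_def)
  have "coherent_configuration \<Omega> T"
  proof
    show "finite \<Omega>" using assms(1) by (rule coherent_configuration.finite_points)
    show "partition_on (\<Omega> \<times> \<Omega>) T" by fact
    have "Id_on \<Omega> \<in> R"
      using coherent_configuration.Id_on_in_relations[OF coh] by (simp add: R_def)
    then show "\<exists>U\<subseteq>T. Id_on \<Omega> = \<Union>U" unfolding relT[symmetric] by (auto simp: relations_def)
  next
    fix s assume "s \<in> T"
    then obtain x y where xy: "x \<in> \<Omega>" "y \<in> \<Omega>" "s = C (x, y)" by (auto simp: T_def)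
    \<comment> \<open>Taking converses permutes \<open>R\<close>, so it carries atoms to
      atoms.\<close>
    have "(u, v) \<in> X \<longleftrightarrow> (v, u) \<in> X\<inverse>" for u v and X :: "('a \<times> 'a) set" by simp
    then have "(v, u) \<in> C (y, x) \<longleftrightarrow> (u, v) \<in> C (x, y)" for u v
      unfolding C_def using R_conv by (auto; metis converse_iff)
    then have "s\<inverse> = C (y, x)" using xy by auto
    then show "s\<inverse> \<in> T" using xy by (auto simp: T_def)
  next
    fix r s t x y x' y'
    assume r: "r \<in> T" and s: "s \<in> T" and t: "t \<in> T" "(x, y) \<in> t" "(x', y') \<in> t"
    let ?m = "\<lambda>p. card (r `` {fst p} \<inter> s\<inverse> `` {snd p})"
    \<comment> \<open>A level set of the path count. Since \<open>r\<close> and \<open>s\<close> are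
      relations of every extension, it is a common relation, and so it contains all of
      \<open>t\<close>.\<close>
    define X where "X = {p \<in> \<Omega> \<times> \<Omega>. ?m p = ?m (x, y)}"
    have rs: "r \<in> R" "s \<in> R" using r s C_R by (auto simp: T_def)
    have "X \<in> R"
    proof (rule RI)
      show "X \<subseteq> \<Omega> \<times> \<Omega>" by (auto simp: X_def)
      fix U p q assume U: "U \<in> F" and pq: "same_block U p q" and p: "p \<in> X"
      have "q \<in> \<Omega> \<times> \<Omega>" using coherent_configuration.same_block_points[OF coh[OF U]] pq
        by (metis SigmaI surj_pair)
      moreover have "?m p = ?m q"
        by (rule coherent_configuration.card_relations_path[OF coh[OF U]])
          (use rs U pq in \<open>auto simp: R_def\<close>)
      ultimately show "q \<in> X" using p by (simp add: X_def)
    qed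
    moreover have "same_block T (x, y) (x', y')" using t by (auto simp: same_block_def)
    moreover have "(x, y) \<in> X" using t partT by (auto simp: X_def partition_on_def)
    ultimately have "(x', y') \<in> X" using relations_iff[OF partT] relT by blast
    then show "card (r `` {x} \<inter> s\<inverse> `` {y}) = card (r `` {x'} \<inter> s\<inverse> `` {y'})"
      by (simp add: X_def)
  qed
  then have "extends_at_points \<Omega> S A T"
    unfolding extends_at_points_def config_le_def relT
    by (auto simp: R_def F_def extends_at_points_def config_le_def)
  moreover have "config_le T T'" if "extends_at_points \<Omega> S A T'" for T'
    using that unfolding config_le_def relT by (auto simp: R_def F_def)
  ultimately show ?thesis by blast
qed

text \<open>Existence and uniqueness together make the \<open>THE\<close> in
  \<open>point_extension\<close> denote the least extension.\<close>

lemma extends_at_points_point_extension: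
  assumes "coherent_configuration \<Omega> S" "A \<subseteq> \<Omega>"
  shows "extends_at_points \<Omega> S A (point_extension \<Omega> S A)"
proof -
  let ?P = "\<lambda>T. extends_at_points \<Omega> S A T \<and> (\<forall>T'. extends_at_points \<Omega> S A T' \<longrightarrow> config_le T T')"
  have "\<exists>!T. ?P T"
  proof (rule ex_ex1I)
    show "\<exists>T. ?P T" by (rule least_extension_exists[OF assms])
    fix T T' assume T: "?P T" "?P T'"
    then have eq: "relations T = relations T'" by (auto simp: config_le_def)
    have "partition_on (\<Omega> \<times> \<Omega>) T" "partition_on (\<Omega> \<times> \<Omega>) T'"
      using T by (auto simp: extends_at_points_def coherent_configuration.partition)
    then show "T = T'"
      using partition_subset_if_relations_eq eq by (metis subset_antisym)
  qed
  from theI'[OF this] show ?thesis by (simp add: point_extension_def)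
qed

subsection \<open>Separated points\<close>

text \<open>For points of \<Omega> this says that an intersection number equals 1: with (a, y) in r
  and (y, b) in s, the only path from \<open>a\<close> to \<open>b\<close> along r and then s passes
  through \<open>y\<close>.\<close>

definition separates :: "('a \<times> 'a) set set \<Rightarrow> 'a \<Rightarrow> 'a \<Rightarrow> 'a \<Rightarrow> bool" where
  "separates S a b y \<longleftrightarrow>
    (\<forall>y'. same_block S (a, y) (a, y') \<longrightarrow> same_block S (b, y) (b, y') \<longrightarrow> y' = y)"

text \<open>The points \<open>a\<close> and \<open>b\<close> pin down \<open>d\<close>, and then
  \<open>a\<close> and \<open>d\<close> pin down \<open>e\<close>. Allowing any \<open>A\<close>
  that contains \<open>a\<close> covers both one and two fixed points.\<close>

lemma separates_chain:
  assumes "coherent_configuration \<Omega> S" "extends_at_points \<Omega> S A T" "a \<in> A" "a \<in> \<Omega>"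
    and "d \<in> \<Omega>" "separates S a b d" "separates S a d e" "same_block T (b, e) (b, e')"
  shows "e' = e"
proof -
  interpret coherent_configuration \<Omega> S by fact
  interpret T: coherent_configuration \<Omega> T
    using assms(2) by (simp add: extends_at_points_def)
  have le: "config_le S T" and fix_a: "{(a, a)} \<in> relations T"
    using assms(2,3) by (auto simp: extends_at_points_def)
  note mono = same_block_mono[OF partition T.partition le]
  \<comment> \<open>Transport \<open>a\<close> along the pair: being fixed, it is its own copy, so
    \<open>u\<close> and \<open>u'\<close> have the same relation to \<open>a\<close> in
    \<open>T\<close>.\<close>
  have a: "same_block T (a, u) (a, u')" if "same_block T (x, u) (x, u')" for x u u'
    by (rule T.same_block_transport[OF that assms(4)])
      (use T.same_block_fixed_point[OF fix_a] in metis)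
  obtain d' where d': "same_block T (b, d) (b, d')" "same_block T (d, e) (d', e')"
    using T.same_block_transport[OF assms(8,5)] .
  have "d' = d"
    using assms(6) mono[OF d'(1)] mono[OF a[OF d'(1)]] by (auto simp: separates_def)
  then show ?thesis
    using assms(7) mono[OF d'(2)] mono[OF a[OF assms(8)]] by (auto simp: separates_def)
qed

section \<open>Counting separated points in a homogeneous configuration\<close>

context homogeneous_configuration
begin

text \<open>The valency of \<open>s\<close> is the intersection number of \<open>s\<close> and
  \<open>s\<inverse>\<close> at the diagonal. The diagonal is a single basis relation, so this
  number is the same at all points.\<close>

lemma card_neighbours_le:
  assumes "s \<in> S" "x \<in> \<Omega>" shows "card (s `` {x}) \<le> max_valency \<Omega> S"
proof -
  have *: "card (s `` {y}) = card (s `` {x})" if "y \<in> \<Omega>" for y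
    using coherent[OF assms(1) converse_closed[OF assms(1)] homogeneous, of y y x x] that assms
    by (simp add: Id_on_iff)
  have "valency \<Omega> s = card (s `` {x})"
    unfolding valency_def by (rule the_equality) (use * assms(2) in blast, use assms(2) in metis)
  then show ?thesis
    unfolding max_valency_def using assms(1) finite_basis_relations
    by (intro Max_ge) (auto intro: image_eqI[of _ _ s])
qed

text \<open>Sorting the counted points z by the basis relation s that contains (x, z) and (y, z)
  gives the summands of c(t), where t is the basis relation of (x, y).\<close>

lemma card_indistinguishing_le:
  assumes "x \<in> \<Omega>" "y \<in> \<Omega>" "x \<noteq> y"
  shows "card {z. same_block S (x, z) (y, z)} \<le> indistinguishing_number \<Omega> S"
proof -
  obtain t where t: "t \<in> S" "(x, y) \<in> t" using assms obtain_basis_relation by blast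
  have num: "intersection_number s (s\<inverse>) t = card (s `` {x} \<inter> s `` {y})" if s: "s \<in> S" for s
    unfolding intersection_number_def
  proof (rule the_equality)
    have "card (s `` {u} \<inter> (s\<inverse>)\<inverse> `` {v}) = card (s `` {x} \<inter> (s\<inverse>)\<inverse> `` {y})"
      if "(u, v) \<in> t" for u v
      by (rule coherent[OF s converse_closed[OF s] t(1) that t(2)])
    then show "\<forall>(u, v)\<in>t. card (s `` {u} \<inter> (s\<inverse>)\<inverse> `` {v}) = card (s `` {x} \<inter> s `` {y})"
      by auto
  qed (use t in auto)
  have "{z. same_block S (x, z) (y, z)} = (\<Union>s\<in>S. s `` {x} \<inter> s `` {y})"
    by (auto simp: same_block_def)
  then have "card {z. same_block S (x, z) (y, z)} \<le> (\<Sum>s\<in>S. card (s `` {x} \<inter> s `` {y}))"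
    by (simp add: card_UN_le[OF finite_basis_relations])
  also have "\<dots> = rel_indistinguishing_number S t"
    by (simp add: rel_indistinguishing_number_def num)
  also have "\<dots> \<le> indistinguishing_number \<Omega> S"
  proof -
    \<comment> \<open>As \<open>x\<close> and \<open>y\<close> differ, \<open>t\<close> is not the
      diagonal and c(t) enters the maximum.\<close>
    have "t \<in> S - {Id_on \<Omega>}" using t assms(3) by auto
    then show ?thesis
      unfolding indistinguishing_number_def using finite_basis_relations by (intro Max_ge) auto
  qed
  finally show ?thesis .
qed

lemma card_not_separates_le:
  assumes "a \<in> \<Omega>" "y \<in> \<Omega>"
  shows "card {b\<in>\<Omega>. \<not> separates S a b y} \<le>
    indistinguishing_number \<Omega> S * (max_valency \<Omega> S - 1)"
proof -
  obtain s where s: "s \<in> S" "(a, y) \<in> s" using assms obtain_basis_relation by blast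
  let ?N = "s `` {a} - {y}" and ?c = "indistinguishing_number \<Omega> S"
  have finN: "finite ?N" using finite_neighbours[OF s(1)] by simp
  have fin: "finite {z. same_block S (y, z) (y', z)}" for y'
    by (rule finite_subset[OF _ finite_points]) (use same_block_points in blast)
  \<comment> \<open>A failing \<open>b\<close> has a witness \<open>y'\<close> in \<open>?N\<close>
    whose basis relation to \<open>b\<close> is that of \<open>y\<close>.\<close>
  have "{b\<in>\<Omega>. \<not> separates S a b y} \<subseteq> (\<Union>y'\<in>?N. {z. same_block S (y, z) (y', z)})"
    using same_block_iff_mem[OF partition s] same_block_converse
    by (auto simp: separates_def)
  then have "card {b\<in>\<Omega>. \<not> separates S a b y} \<le>
      card (\<Union>y'\<in>?N. {z. same_block S (y, z) (y', z)})"
    using finN fin by (intro card_mono) auto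
  also have "\<dots> \<le> (\<Sum>y'\<in>?N. card {z. same_block S (y, z) (y', z)})"
    by (rule card_UN_le[OF finN])
  also have "\<dots> \<le> of_nat (card ?N) * ?c"
    by (rule sum_bounded_above, rule card_indistinguishing_le)
      (use assms s basis_relation_subset in auto)
  \<comment> \<open>Removing \<open>y\<close> itself from its own neighbourhood of \<open>a\<close>
    yields the k - 1.\<close>
  also have "\<dots> \<le> (max_valency \<Omega> S - 1) * ?c"
    using card_neighbours_le[OF s(1) assms(1)] s finite_neighbours[OF s(1)]
    by (intro mult_le_mono1) (simp add: card_Diff_singleton)
  finally show ?thesis by (simp add: mult.commute)
qed

lemma separating_point_exists:
  assumes "2 * indistinguishing_number \<Omega> S * (max_valency \<Omega> S - 1) < card \<Omega>" "a \<in> \<Omega>"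
  shows "\<exists>b\<in>\<Omega>. \<forall>e\<in>\<Omega>. \<exists>d\<in>\<Omega>. separates S a b d \<and> separates S a d e"
proof -
  let ?n = "card \<Omega>"
  have many: "?n < 2 * card {b\<in>\<Omega>. separates S a b y}" if "y \<in> \<Omega>" for y
  proof -
    have "?n = card {b\<in>\<Omega>. separates S a b y} + card {b\<in>\<Omega>. \<not> separates S a b y}"
      using finite_points
      by (subst card_Un_disjoint[symmetric]) (auto intro!: arg_cong[of _ _ card])
    then show ?thesis using card_not_separates_le[OF assms(2) that] assms(1) by linarith
  qed
  have "\<exists>b\<in>\<Omega>. ?n < 2 * card {y\<in>\<Omega>. separates S a b y}"
  proof (rule ccontr)
    assume "\<not> ?thesis"
    then have few: "2 * card {y\<in>\<Omega>. separates S a b y} \<le> ?n" if "b \<in> \<Omega>" for b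
      using that by force
    have "?n * ?n = (\<Sum>y\<in>\<Omega>. ?n)" by simp
    \<comment> \<open>Strictness of the sum needs a nonempty \<Omega>, which \<open>a\<close>
      provides.\<close>
    also have "\<dots> < (\<Sum>y\<in>\<Omega>. 2 * card {b\<in>\<Omega>. separates S a b y})"
      using finite_points assms(2) many by (intro sum_strict_mono) auto
    also have "\<dots> = 2 * (\<Sum>y\<in>\<Omega>. card {b\<in>\<Omega>. separates S a b y})"
      by (simp add: sum_distrib_left)
    also have "(\<Sum>y\<in>\<Omega>. card {b\<in>\<Omega>. separates S a b y}) =
        (\<Sum>b\<in>\<Omega>. card {y\<in>\<Omega>. separates S a b y})"
      by (rule sum_multicount_gen[symmetric]) (use finite_points in auto)
    also have "2 * \<dots> = (\<Sum>b\<in>\<Omega>. 2 * card {y\<in>\<Omega>. separates S a b y})"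
      by (simp add: sum_distrib_left)
    also have "\<dots> \<le> (\<Sum>b\<in>\<Omega>. ?n)" using few by (rule sum_mono)
    finally show False by simp
  qed
  then obtain b where b: "b \<in> \<Omega>" "?n < 2 * card {d\<in>\<Omega>. separates S a b d}" by blast
  \<comment> \<open>Two subsets that each contain more than half of \<Omega> must meet; a common
    element is the desired \<open>d\<close>.\<close>
  have "\<exists>d\<in>\<Omega>. separates S a b d \<and> separates S a d e" if "e \<in> \<Omega>" for e
  proof (rule ccontr)
    assume "\<not> ?thesis"
    then have disj: "{d\<in>\<Omega>. separates S a b d} \<inter> {d\<in>\<Omega>. separates S a d e} = {}" by blast
    have "card {d\<in>\<Omega>. separates S a b d} + card {d\<in>\<Omega>. separates S a d e} =
        card ({d\<in>\<Omega>. separates S a b d} \<union> {d\<in>\<Omega>. separates S a d e})"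
      using disj finite_points by (intro card_Un_disjoint[symmetric]) auto
    also have "\<dots> \<le> ?n" using finite_points by (intro card_mono) auto
    finally show False using b(2) many[OF that] by linarith
  qed
  with b(1) show ?thesis by blast
qed

end

theorem theorem3p1:
  fixes \<Omega> :: "'a set" and S :: "('a \<times> 'a) set set"
  assumes "homogeneous_configuration \<Omega> S"
    and "2 * indistinguishing_number \<Omega> S * (max_valency \<Omega> S - 1) < card \<Omega>"
  shows "(\<forall>\<alpha>\<in>\<Omega>. one_regular \<Omega> (point_extension \<Omega> S {\<alpha>})) \<and> base_number \<Omega> S \<le> 2"
proof -
  interpret homogeneous_configuration \<Omega> S by fact
  \<comment> \<open>Here \<open>b\<close> is chosen from \<open>S\<close> and \<open>a\<close>
    alone, before \<open>A\<close> and \<open>T\<close>. So the same \<open>b\<close> may later be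
    put into \<open>A\<close>.\<close>
  have key: "\<exists>b\<in>\<Omega>. \<forall>A T e e'. a \<in> A \<longrightarrow> extends_at_points \<Omega> S A T \<longrightarrow>
      same_block T (b, e) (b, e') \<longrightarrow> e' = e" if a: "a \<in> \<Omega>" for a
  proof -
    obtain b where b: "b \<in> \<Omega>"
        "\<forall>e\<in>\<Omega>. \<exists>d\<in>\<Omega>. separates S a b d \<and> separates S a d e"
      using separating_point_exists[OF assms(2) a] by blast
    have "e' = e" if *: "a \<in> A" "extends_at_points \<Omega> S A T" "same_block T (b, e) (b, e')"
      for A T e e'
    proof -
      have "coherent_configuration \<Omega> T" using *(2) by (simp add: extends_at_points_def)
      then have "e \<in> \<Omega>" using coherent_configuration.same_block_points *(3) by metis
      then obtain d where "d \<in> \<Omega>" "separates S a b d" "separates S a d e" using b by blast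
      with * a show ?thesis using separates_chain[OF coherent_configuration_axioms] by metis
    qed
    with b(1) show ?thesis by blast
  qed
  have "one_regular \<Omega> (point_extension \<Omega> S {a})" if a: "a \<in> \<Omega>" for a
  proof -
    let ?T = "point_extension \<Omega> S {a}"
    have T: "extends_at_points \<Omega> S {a} ?T"
      using extends_at_points_point_extension[OF coherent_configuration_axioms] a by simp
    obtain b where b: "b \<in> \<Omega>" "\<And>e e'. same_block ?T (b, e) (b, e') \<Longrightarrow> e' = e"
      using key[OF a] T by blast
    have "card (r `` {b}) \<le> 1" if "r \<in> ?T" for r
    proof -
      have "u = v" if "u \<in> r `` {b}" "v \<in> r `` {b}" for u v
        using b(2) that \<open>r \<in> ?T\<close> unfolding same_block_def by blast
      \<comment> \<open>An infinite set has \<open>card\<close> 0, so the bound holds in either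
        case.\<close>
      then show ?thesis by (metis One_nat_def card_le_Suc0_iff_eq card.infinite le0)
    qed
    then show ?thesis using b(1) by (auto simp: one_regular_def regular_point_def)
  qed
  moreover have "base_number \<Omega> S \<le> 2"
  proof -
    obtain a where a: "a \<in> \<Omega>" using assms(2) by fastforce
    obtain b where b: "b \<in> \<Omega>" "\<And>A T e e'. a \<in> A \<Longrightarrow> extends_at_points \<Omega> S A T \<Longrightarrow>
      same_block T (b, e) (b, e') \<Longrightarrow> e' = e" using key[OF a] by blast
    let ?T = "point_extension \<Omega> S {a, b}"
    have T: "extends_at_points \<Omega> S {a, b} ?T"
      using extends_at_points_point_extension[OF coherent_configuration_axioms] a b(1) by simp
    then interpret T: coherent_configuration \<Omega> ?T by (simp add: extends_at_points_def)
    have fix_b: "{(b, b)} \<in> relations ?T" using T by (auto simp: extends_at_points_def)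
    have inj: "e' = e" if "same_block ?T (b, e) (b, e')" for e e' using b(2)[OF _ T that] by simp
    \<comment> \<open>Transporting the fixed point \<open>b\<close> between \<open>x\<close> and
      \<open>y\<close> gives \<open>b\<close> again, and both ends are determined by their relation
      to \<open>b\<close>.\<close>
    have eq: "x' = x \<and> y' = y" if xy: "same_block ?T (x, y) (x', y')" for x y x' y'
    proof -
      obtain z where z: "same_block ?T (x, b) (x', z)" "same_block ?T (b, y) (z, y')"
        using T.same_block_transport[OF xy b(1)] .
      have "z = b" using T.same_block_fixed_point[OF fix_b z(2)] .
      with z show ?thesis using inj T.same_block_converse by blast
    qed
    have "is_singleton t" if t: "t \<in> ?T" for t
    proof -
      have "t \<noteq> {}" using T.partition t by (auto simp: partition_on_def)
      then obtain x y where xy: "(x, y) \<in> t" by fast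
      have "p = (x, y)" if "p \<in> t" for p
        using eq[of x y "fst p" "snd p"] t xy that by (auto simp: same_block_def prod_eq_iff)
      with xy have "t = {(x, y)}" by blast
      then show ?thesis by simp
    qed
    then have "is_base \<Omega> S {a, b}"
      using a b(1) by (simp add: is_base_def complete_configuration_def)
    moreover have "finite {A. is_base \<Omega> S A}"
      by (rule finite_subset[of _ "Pow \<Omega>"]) (use finite_points in \<open>auto simp: is_base_def\<close>)
    ultimately have "base_number \<Omega> S \<le> card {a, b}"
      unfolding base_number_def by (intro Min_le) auto
    \<comment> \<open>Only an inequality, since \<open>a\<close> and \<open>b\<close> may
      coincide.\<close>
    also have "\<dots> \<le> 2" by (simp add: card_insert_if)
    finally show ?thesis .
  qed
  ultimately show ?thesis by blast
qed

end
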